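(* Let $\mathcal{C}=[-1,1]^n$ and let $S\subset\mathcal{C}$ be countably $1$-rectifiable and Borel measurable. Let $\xi\in L^1(\mathcal{H}^1\llcorner S;\mathbb{R}^n)$, and let $\tau$ be a transportation cost with $\tau'(0)=\lim_{m\searrow 0}\tau(m)/m<\infty$, with associated maintenance cost $\varepsilon$. Then $$\int_S\tau(|\xi|)\,\mathrm{d}\mathcal{H}^1=\inf_b\int_S b|\xi|\,\mathrm{d}\mathcal{H}^1+\int_S\varepsilon(b)\,\mathrm{d}\mathcal{H}^1,$$ where the infimum (of the sum of both integrals) is taken over all lower semi-continuous functions $b:S\to[0,\tau'(0)]$.
   Context: A set $S\subset\mathbb{R}^n$ is countably $1$-rectifiable if $S=\bigcup_{i=1}^\infty f_i(A_i)$ with $A_i\subset\mathbb{R}$ bounded and $f_i:A_i\to\mathbb{R}^n$ Lipschitz. $\mathcal{H}^1$ is the one-dimensional Hausdorff measure, and $\mathcal{H}^1\llcorner S$ its restriction to $S$. A transportation cost is a non-decreasing concave function $\tau:[0,\infty)\to[0,\infty)$ with $\tau(0)=0$. The maintenance cost associated with $\tau$ is $\varepsilon:[0,\infty)\to[0,\infty]$, $\varepsilon(b)=\sup_{m\geq 0}\big(\tau(m)-bm\big)$. *)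

theory Defs
  imports "HOL-Analysis.Analysis"
begin

text \<open>
  The size-\<open>\<delta>\<close> approximation of one-dimensional Hausdorff measure. The usual summand
  \<open>\<omega>\<^sub>1 * (diam C / 2)\<close> with \<open>\<omega>\<^sub>1 = 2\<close> is just \<open>diam C\<close>. Boundedness of the covering sets is
  required separately because \<^const>\<open>diameter\<close> is real-valued and hence unspecified on
  unbounded sets. The infimum over no coverings at all is \<open>\<infinity>\<close>.
\<close>

definition hausdorff1_delta :: "real \<Rightarrow> 'a::metric_space set \<Rightarrow> ennreal" where
  "hausdorff1_delta \<delta> A =
     (INF C\<in>{C :: nat \<Rightarrow> 'a set. A \<subseteq> (\<Union>i. C i) \<and> (\<forall>i. bounded (C i) \<and> diameter (C i) \<le> \<delta>)}.
        \<Sum>i. ennreal (diameter (C i)))"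

definition hausdorff1_outer :: "'a::metric_space set \<Rightarrow> ennreal" where
  "hausdorff1_outer A = (SUP \<delta>\<in>{0<..}. hausdorff1_delta \<delta> A)"

text \<open>
  The measure \<open>\<H>\<^sup>1\<close>, on the \<open>\<sigma>\<close>-algebra of all Caratheodory-measurable sets (which contains
  the Borel sets). Its restriction to \<open>S\<close> is \<open>restrict_space hausdorff1 S\<close>.
\<close>

definition hausdorff1 :: "'a::metric_space measure" where
  "hausdorff1 = measure_of UNIV (lambda_system UNIV (Pow UNIV) hausdorff1_outer) hausdorff1_outer"

definition countably_1_rectifiable :: "'a::metric_space set \<Rightarrow> bool" where
  "countably_1_rectifiable S \<longleftrightarrow>
     (\<exists>(A :: nat \<Rightarrow> real set) (f :: nat \<Rightarrow> real \<Rightarrow> 'a).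
        (\<forall>i. bounded (A i) \<and> (\<exists>L. L-lipschitz_on (A i) (f i))) \<and> S = (\<Union>i. f i ` A i))"

text \<open>Only the values of \<open>\<tau>\<close> on \<open>[0,\<infinity>)\<close> are relevant here and below.\<close>

definition transportation_cost :: "(real \<Rightarrow> real) \<Rightarrow> bool" where
  "transportation_cost \<tau> \<longleftrightarrow>
     (\<forall>m\<ge>0. 0 \<le> \<tau> m) \<and> mono_on {0..} \<tau> \<and> concave_on {0..} \<tau> \<and> \<tau> 0 = 0"

text \<open>
  \<^const>\<open>ennreal\<close> truncates negative values of \<open>\<tau> m - b * m\<close> to \<open>0\<close>; since \<open>m = 0\<close> already
  contributes \<open>\<tau> 0 - b * 0 = 0\<close>, this does not affect the supremum.
\<close>

definition maintenance_cost :: "(real \<Rightarrow> real) \<Rightarrow> real \<Rightarrow> ennreal" where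
  "maintenance_cost \<tau> b = (SUP m\<in>{0..}. ennreal (\<tau> m - b * m))"

definition lower_semicontinuous_on :: "'a::topological_space set \<Rightarrow> ('a \<Rightarrow> real) \<Rightarrow> bool" where
  "lower_semicontinuous_on S b \<longleftrightarrow>
     (\<forall>x\<in>S. \<forall>y<b x. eventually (\<lambda>z. y < b z) (at x within S))"

end

theory Submission
  imports Defs
begin

text \<open>
  The maintenance cost is a Fenchel conjugate, so for every \<open>m \<ge> 0\<close> and every slope \<open>s \<ge> 0\<close>
  the inequality \<open>\<tau> m \<le> s * m + \<epsilon> s\<close> holds, where \<open>\<epsilon>\<close> denotes the maintenance cost. Equality
  holds if \<open>s\<close> is a supergradient of \<open>\<tau>\<close> at \<open>m\<close>. Integrating the inequality with
  \<open>m = norm (\<xi> x)\<close> and \<open>s = b x\<close> bounds the left-hand side by each of the costs on the right.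

  For the converse, choose a supergradient \<open>\<beta> m\<close> of \<open>\<tau>\<close> at every \<open>m\<close>, with values in \<open>[0,\<tau>'0]\<close>
  (\<open>transportation_cost_supergradient\<close>). The slope \<open>g x = \<beta> (norm (\<xi> x))\<close> attains equality pointwise, but it is merely
  measurable. It has to be replaced by a lower semicontinuous \<open>b\<close> with almost the same
  cost. The direction of the approximation is decisive: if \<open>g \<le> b \<le> \<tau>'0\<close>, then
  \<open>\<epsilon> \<circ> b \<le> \<epsilon> \<circ> g\<close> because \<open>\<epsilon>\<close> is antitone, so the maintenance term, which is integrated
  against a possibly infinite measure, takes care of itself. Only the integral of
  \<open>b - g\<close> against \<open>norm (\<xi> x)\<close> times Hausdorff measure needs to be small. This is a finite
  measure, and the approximation is the Vitali-Caratheodory theorem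
  (\<open>vitali_caratheodory_above\<close>).

  That theorem rests on the approximation of measurable sets by open supersets
  (\<open>weighted_hausdorff1_outer_regular\<close>). Here measurable means Caratheodory measurable with respect to
  Hausdorff measure. Outer regularity of finite Borel measures on Polish spaces therefore
  applies only after Borel sets are known to be Caratheodory measurable
  (\<open>sets_borel_subset_hausdorff1\<close>, from the fact that Hausdorff measure is a metric outer
  measure) and measurable sets of finite measure are known to be Borel up to null sets
  (\<open>hausdorff1_borel_kernel\<close>).
\<close>

section \<open>Metric outer measures\<close>

text \<open>
  Caratheodory's criterion. A test set \<open>A\<close> splits into \<open>A \<inter> F\<close> and the layers of \<open>A\<close> according to
  the distance from \<open>F\<close>. The part \<open>K n\<close> at distance at least \<open>1 / (n + 1)\<close> is separated from
  \<open>A \<inter> F\<close>, so additivity holds for these two. What remains is exhausted by the shells \<open>R k\<close>, and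
  shells whose indices have the same parity are separated from each other. Hence the sum of
  \<open>\<phi> (R k)\<close> is at most \<open>2 * \<phi> A\<close>. If \<open>\<phi> A\<close> is finite, its tail, which bounds the error made in replacing
  \<open>A - F\<close> by \<open>K n\<close>, vanishes as \<open>n\<close> grows.
\<close>

lemma metric_outer_measure_closed:
  fixes \<phi> :: "'a::metric_space set \<Rightarrow> ennreal"
  assumes oms: "outer_measure_space UNIV \<phi>"
    and add: "\<And>A B r. r > 0 \<Longrightarrow> (\<And>x y. x \<in> A \<Longrightarrow> y \<in> B \<Longrightarrow> r \<le> dist x y) \<Longrightarrow> \<phi> A + \<phi> B \<le> \<phi> (A \<union> B)"
    and F: "closed F"
  shows "F \<in> lambda_system UNIV UNIV \<phi>"
proof -
  interpret algebra UNIV "UNIV :: 'a set set" using algebra_Pow[of UNIV] by simp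
  have emp: "\<phi> {} = 0" and mono: "\<And>A B. A \<subseteq> B \<Longrightarrow> \<phi> A \<le> \<phi> B"
    using oms by (auto simp: outer_measure_space_def positive_def increasing_def)
  have csub: "\<phi> (\<Union>i. A i) \<le> (\<Sum>i. \<phi> (A i))" for A :: "nat \<Rightarrow> 'a set"
  proof -
    have "\<phi> (\<Union>i. disjointed A i) \<le> (\<Sum>i. \<phi> (disjointed A i))"
      using oms disjoint_family_disjointed[of A]
      unfolding outer_measure_space_def countably_subadditive_def by blast
    also have "\<dots> \<le> (\<Sum>i. \<phi> (A i))"
      by (intro suminf_le mono disjointed_subset) auto
    finally show ?thesis by (simp add: UN_disjointed_eq)
  qed
  have sub: "\<phi> (A \<union> B) \<le> \<phi> A + \<phi> B" for A B
  proof -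
    have "subadditive UNIV \<phi>"
      using countably_subadditive_subadditive[of \<phi>] oms by (auto simp: outer_measure_space_def)
    then have "\<phi> (A \<union> (B - A)) \<le> \<phi> A + \<phi> (B - A)"
      by (rule subadditiveD) auto
    also have "\<dots> \<le> \<phi> A + \<phi> B" by (intro add_left_mono mono) auto
    finally show ?thesis by simp
  qed
  have ineq: "\<phi> (A \<inter> F) + \<phi> (A - F) \<le> \<phi> A" if Fne: "F \<noteq> {}" for A
  proof (cases "\<phi> A = top")
    case False
    define d where "d x = infdist x F" for x
    define K where "K n = {x \<in> A. 1 / real (n + 1) \<le> d x}" for n
    define R where "R k = {x \<in> A. 1 / real (k + 2) \<le> d x \<and> d x < 1 / real (k + 1)}" for k
    have lip: "d x \<le> d y + dist x y" for x y
      unfolding d_def by (rule infdist_triangle)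
    have pos: "d x > 0" if "x \<notin> F" for x
      using that F Fne in_closed_iff_infdist_zero[of F x] infdist_nonneg[of x F]
      by (force simp: d_def less_le)
    have zero: "d x = 0" if "x \<in> F" for x using that by (simp add: d_def)
    have alternate: "(\<Sum>k<N. \<phi> (R (2*k+p))) \<le> \<phi> (\<Union>k<N. R (2*k+p))" for N p
    proof (induction N)
      case (Suc N)
      have "\<phi> (\<Union>k<N. R (2*k+p)) + \<phi> (R (2*N+p)) \<le> \<phi> ((\<Union>k<N. R (2*k+p)) \<union> R (2*N+p))"
      proof (cases "N = 0")
        case False
        show ?thesis
        proof (rule add)
          show "0 < 1 / real (2*N+p) - 1 / real (2*N+p+1)"
            using divide_strict_left_mono[of "real (2*N+p)" "real (2*N+p+1)" 1] False by simp
          fix x y assume "x \<in> (\<Union>k<N. R (2*k+p))" and y: "y \<in> R (2*N+p)"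
          then obtain k where k: "k < N" "x \<in> R (2*k+p)" by auto
          have "1 / real (2*N+p) \<le> 1 / real (2*k+p+2)"
            using k(1) by (intro divide_left_mono) auto
          also have "\<dots> \<le> d x" using k(2) by (simp add: R_def)
          finally have "1 / real (2*N+p) \<le> d x" .
          moreover have "d y < 1 / real (2*N+p+1)" using y by (simp add: R_def)
          ultimately show "1 / real (2*N+p) - 1 / real (2*N+p+1) \<le> dist x y"
            using lip[of x y] by linarith
        qed
      qed (simp add: emp)
      moreover have "(\<Union>k<N. R (2*k+p)) \<union> R (2*N+p) = (\<Union>k<Suc N. R (2*k+p))"
        by (auto simp: less_Suc_eq)
      ultimately show ?case
        using Suc.IH by (simp) (meson add_right_mono order_trans)
    qed (simp add: emp)
    have alternate': "(\<Sum>k<N. \<phi> (R (2*k+p))) \<le> \<phi> A" for N p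
      using alternate[of p N] by (rule order_trans) (intro mono, auto simp: R_def)
    have "(\<Sum>k<N. \<phi> (R k)) \<le> 2 * \<phi> A" for N
    proof -
      have "(\<Sum>k<N. \<phi> (R k)) \<le> (\<Sum>k<2*N. \<phi> (R k))"
        by (intro sum_mono2) auto
      also have "\<dots> = (\<Sum>k<N. \<phi> (R (2*k+0))) + (\<Sum>k<N. \<phi> (R (2*k+1)))"
        by (induction N) (auto simp: ac_simps)
      also have "\<dots> \<le> \<phi> A + \<phi> A" by (intro add_mono alternate')
      finally show ?thesis by (simp add: mult_2)
    qed
    then have "(\<Sum>k. \<phi> (R k)) \<le> 2 * \<phi> A"
      by (intro suminf_le_const) auto
    also have "\<dots> < top" using False by (simp add: ennreal_mult_less_top less_top)
    finally have fin: "(\<Sum>k. \<phi> (R k)) < top" .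
    show ?thesis
    proof (rule ennreal_le_epsilon)
      fix e :: real assume e: "0 < e"
      \<comment> \<open>Tails of convergent series vanish in the reals, so the values are transferred there.\<close>
      define q where "q k = enn2real (\<phi> (R k))" for k
      have "\<phi> (R k) < top" for k
      proof -
        have "\<phi> (R k) \<le> \<phi> A" by (intro mono) (auto simp: R_def)
        then show ?thesis using False by (simp add: less_top order_le_less_trans)
      qed
      then have q: "\<phi> (R k) = ennreal (q k)" for k by (simp add: q_def)
      have qnn: "0 \<le> q k" for k by (simp add: q_def)
      have "summable q"
        using fin qnn by (intro summable_suminf_not_top) (auto simp: q)
      from suminf_exist_split[OF e this] obtain n where n: "norm (\<Sum>i. q (i + n)) < e" by blast
      have sq: "summable (\<lambda>i. q (i + n))" using \<open>summable q\<close> by (simp add: summable_iff_shift)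
      have cover: "A - F \<subseteq> K n \<union> (\<Union>k. R (k + n))"
      proof
        fix x assume x: "x \<in> A - F"
        have "\<exists>m. 1 / real (m + 1) \<le> d x"
          using nat_approx_posE[of "d x"] pos[of x] x by (metis DiffD2 Suc_eq_plus1 less_imp_le)
        then obtain m where m: "1 / real (m + 1) \<le> d x" "\<And>j. j < m \<Longrightarrow> \<not> 1 / real (j + 1) \<le> d x"
          using exists_least_iff[of "\<lambda>m. 1 / real (m + 1) \<le> d x"] by blast
        show "x \<in> K n \<union> (\<Union>k. R (k + n))"
        proof (cases "m \<le> n")
          case True
          then have "1 / real (n + 1) \<le> 1 / real (m + 1)" by (simp add: field_simps)
          then show ?thesis using m(1) x by (auto simp: K_def)
        next
          case False
          then have "x \<in> R ((m - 1 - n) + n)"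
            using m(1) m(2)[of "m - 1"] x by (auto simp: R_def not_le)
          then show ?thesis by blast
        qed
      qed
      have "\<phi> (A - F) \<le> \<phi> (K n) + \<phi> (\<Union>k. R (k + n))"
        using mono[OF cover] sub order_trans by blast
      also have "\<dots> \<le> \<phi> (K n) + (\<Sum>k. \<phi> (R (k + n)))"
        by (intro add_left_mono csub)
      also have "(\<Sum>k. \<phi> (R (k + n))) = ennreal (\<Sum>k. q (k + n))"
        using sq qnn by (simp add: q suminf_ennreal2)
      also have "\<dots> \<le> ennreal e" using n by (intro ennreal_leI) auto
      finally have 1: "\<phi> (A - F) \<le> \<phi> (K n) + ennreal e" by (simp add: add_left_mono)
      have "\<phi> (A \<inter> F) + \<phi> (K n) \<le> \<phi> ((A \<inter> F) \<union> K n)"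
      proof (rule add)
        show "0 < 1 / real (n + 1)" by simp
        fix x y assume "x \<in> A \<inter> F" "y \<in> K n"
        then show "1 / real (n + 1) \<le> dist x y"
          using lip[of y x] zero[of x] by (auto simp: K_def dist_commute)
      qed
      also have "\<dots> \<le> \<phi> A" by (intro mono) (auto simp: K_def)
      finally have 2: "\<phi> (A \<inter> F) + \<phi> (K n) \<le> \<phi> A" .
      have "\<phi> (A \<inter> F) + \<phi> (A - F) \<le> \<phi> (A \<inter> F) + (\<phi> (K n) + ennreal e)"
        by (intro add_left_mono 1)
      also have "\<dots> \<le> \<phi> A + ennreal e"
        using 2 by (simp add: add.assoc[symmetric] add_right_mono)
      finally show "\<phi> (A \<inter> F) + \<phi> (A - F) \<le> \<phi> A + ennreal e" .
    qed
  qed simp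
  have "\<phi> (A \<inter> F) + \<phi> (A - F) = \<phi> A" for A
  proof (rule antisym)
    show "\<phi> (A \<inter> F) + \<phi> (A - F) \<le> \<phi> A"
      using ineq by (cases "F = {}") (auto simp: emp)
    show "\<phi> A \<le> \<phi> (A \<inter> F) + \<phi> (A - F)"
      using sub[of "A \<inter> F" "A - F"] by (simp add: Int_Diff_Un)
  qed
  then show ?thesis by (simp add: lambda_system_eq)
qed

section \<open>One-dimensional Hausdorff measure\<close>

lemma hausdorff1_delta_le:
  assumes "A \<subseteq> (\<Union>i::nat. C i)" "\<And>i. bounded (C i)" "\<And>i. diameter (C i) \<le> \<delta>"
  shows "hausdorff1_delta \<delta> A \<le> (\<Sum>i. ennreal (diameter (C i)))"
  unfolding hausdorff1_delta_def by (rule INF_lower) (use assms in simp)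

lemma hausdorff1_delta_greatest:
  assumes "\<And>C. \<lbrakk>A \<subseteq> (\<Union>i::nat. C i); \<And>i. bounded (C i); \<And>i. diameter (C i) \<le> \<delta>\<rbrakk>
    \<Longrightarrow> z \<le> (\<Sum>i. ennreal (diameter (C i)))"
  shows "z \<le> hausdorff1_delta \<delta> A"
  unfolding hausdorff1_delta_def by (rule INF_greatest) (use assms in simp)

lemma hausdorff1_delta_mono:
  assumes "A \<subseteq> B" shows "hausdorff1_delta \<delta> A \<le> hausdorff1_delta \<delta> B"
  by (intro hausdorff1_delta_greatest hausdorff1_delta_le order_trans[OF assms])

lemma hausdorff1_delta_antimono:
  assumes "\<delta> \<le> \<delta>'" shows "hausdorff1_delta \<delta>' A \<le> hausdorff1_delta \<delta> A"
  by (intro hausdorff1_delta_greatest hausdorff1_delta_le order_trans[OF _ assms])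

lemma hausdorff1_delta_empty: "0 < \<delta> \<Longrightarrow> hausdorff1_delta \<delta> {} = 0"
  using hausdorff1_delta_le[of "{}" "\<lambda>_. {}" \<delta>] by simp

lemma hausdorff1_delta_approx:
  assumes "hausdorff1_delta \<delta> A < top" "0 < e"
  obtains C where "A \<subseteq> (\<Union>i::nat. C i)" "\<And>i. bounded (C i)" "\<And>i. diameter (C i) \<le> \<delta>"
    "(\<Sum>i. ennreal (diameter (C i))) \<le> hausdorff1_delta \<delta> A + ennreal e"
proof -
  have "hausdorff1_delta \<delta> A \<noteq> \<infinity>" using assms(1) by simp
  from INF_approx_ennreal[OF assms(2) hausdorff1_delta_def[of \<delta> A] this]
  obtain C where C: "C \<in> {C. A \<subseteq> (\<Union>i::nat. C i) \<and> (\<forall>i. bounded (C i) \<and> diameter (C i) \<le> \<delta>)}"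
    "(\<Sum>i. ennreal (diameter (C i))) < hausdorff1_delta \<delta> A + ennreal e"
    by (rule bexE)
  show ?thesis by (rule that[of C]) (use C in \<open>simp_all add: less_imp_le\<close>)
qed

text \<open>
  Almost optimal coverings of the single sets, with errors forming a geometric series, are
  merged into one covering by enumerating pairs of indices.
\<close>

lemma hausdorff1_delta_countably_subadditive:
  "hausdorff1_delta \<delta> (\<Union>i. A i) \<le> (\<Sum>i. hausdorff1_delta \<delta> (A i))"
proof (rule ennreal_le_epsilon)
  fix e :: real assume e: "0 < e" and fin: "(\<Sum>i. hausdorff1_delta \<delta> (A i)) < top"
  have "\<exists>C. A i \<subseteq> (\<Union>j::nat. C j) \<and> (\<forall>j. bounded (C j) \<and> diameter (C j) \<le> \<delta>) \<and>
      (\<Sum>j. ennreal (diameter (C j))) \<le> hausdorff1_delta \<delta> (A i) + ennreal (e * (1/2)^Suc i)" for i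
  proof -
    have "hausdorff1_delta \<delta> (A i) < top"
      using fin ennreal_suminf_lessD by blast
    from hausdorff1_delta_approx[OF this, of "e * (1/2)^Suc i"] e show ?thesis
      by (metis mult_pos_pos zero_less_power half_gt_zero_iff zero_less_one)
  qed
  then obtain C where C: "\<And>i. A i \<subseteq> (\<Union>j::nat. C i j)"
      "\<And>i j. bounded (C i j) \<and> diameter (C i j) \<le> \<delta>"
      "\<And>i. (\<Sum>j. ennreal (diameter (C i j))) \<le> hausdorff1_delta \<delta> (A i) + ennreal (e * (1/2)^Suc i)"
    by metis
  have "hausdorff1_delta \<delta> (\<Union>i. A i) \<le> (\<Sum>k. ennreal (diameter (case_prod C (prod_decode k))))"
  proof (rule hausdorff1_delta_le, safe)
    fix x i assume "x \<in> A i"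
    then obtain j where "x \<in> C i j" using C(1) by blast
    then show "x \<in> (\<Union>k. case_prod C (prod_decode k))"
      by (intro UN_I[of "prod_encode (i, j)"]) auto
  qed (use C(2) in \<open>auto split: prod.split\<close>)
  also have "\<dots> = (\<Sum>i. \<Sum>j. ennreal (diameter (C i j)))"
    by (rule suminf_ennreal_2dimen[where f = "\<lambda>p. ennreal (diameter (case_prod C p))"]) simp
  also have "\<dots> \<le> (\<Sum>i. hausdorff1_delta \<delta> (A i) + ennreal (e * (1/2)^Suc i))"
    by (intro suminf_le C(3)) auto
  also have "\<dots> = (\<Sum>i. hausdorff1_delta \<delta> (A i)) + (\<Sum>i. ennreal (e * (1/2)^Suc i))"
    by (intro suminf_add[symmetric]) auto
  also have "(\<Sum>i. ennreal (e * (1/2)^Suc i)) = ennreal e"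
    using e sums_mult[OF power_half_series, of e] by (intro suminf_ennreal_eq) auto
  finally show "hausdorff1_delta \<delta> (\<Union>i. A i) \<le> (\<Sum>i. hausdorff1_delta \<delta> (A i)) + ennreal e" .
qed

lemma hausdorff1_delta_le_outer: "0 < \<delta> \<Longrightarrow> hausdorff1_delta \<delta> A \<le> hausdorff1_outer A"
  unfolding hausdorff1_outer_def by (intro SUP_upper) auto

lemma hausdorff1_outer_measure_space:
  "outer_measure_space UNIV (hausdorff1_outer :: 'a::metric_space set \<Rightarrow> ennreal)"
  unfolding outer_measure_space_def
proof (intro conjI)
  show "positive UNIV (hausdorff1_outer :: 'a set \<Rightarrow> ennreal)"
  proof -
    have "hausdorff1_outer ({} :: 'a set) \<le> 0"
      unfolding hausdorff1_outer_def by (rule SUP_least) (simp add: hausdorff1_delta_empty)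
    then show ?thesis by (simp add: positive_def)
  qed
  show "increasing UNIV (hausdorff1_outer :: 'a set \<Rightarrow> ennreal)"
  proof -
    have "hausdorff1_outer A \<le> hausdorff1_outer B" if "A \<subseteq> B" for A B :: "'a set"
      unfolding hausdorff1_outer_def by (rule SUP_mono') (rule hausdorff1_delta_mono[OF that])
    then show ?thesis by (simp add: increasing_def)
  qed
  show "countably_subadditive UNIV (hausdorff1_outer :: 'a set \<Rightarrow> ennreal)"
    unfolding countably_subadditive_def
  proof (intro allI ballI impI)
    fix A :: "nat \<Rightarrow> 'a set"
    show "hausdorff1_outer (\<Union>i. A i) \<le> (\<Sum>i. hausdorff1_outer (A i))"
      unfolding hausdorff1_outer_def[of "\<Union>i. A i"]
    proof (rule SUP_least)
      fix \<delta> :: real assume "\<delta> \<in> {0<..}"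
      then have "(\<Sum>i. hausdorff1_delta \<delta> (A i)) \<le> (\<Sum>i. hausdorff1_outer (A i))"
        by (intro suminf_le hausdorff1_delta_le_outer) auto
      then show "hausdorff1_delta \<delta> (\<Union>i. A i) \<le> (\<Sum>i. hausdorff1_outer (A i))"
        using hausdorff1_delta_countably_subadditive order_trans by blast
    qed
  qed
qed

text \<open>
  A covering set of diameter less than the distance of \<open>A\<close> and \<open>B\<close> cannot meet both, so every
  covering of the union falls apart into a covering of \<open>A\<close> and one of \<open>B\<close>.
\<close>

lemma hausdorff1_delta_separated:
  fixes A B :: "'a::metric_space set"
  assumes \<delta>: "0 < \<delta>" "\<delta> < r" and sep: "\<And>x y. x \<in> A \<Longrightarrow> y \<in> B \<Longrightarrow> r \<le> dist x y"
  shows "hausdorff1_delta \<delta> A + hausdorff1_delta \<delta> B \<le> hausdorff1_delta \<delta> (A \<union> B)"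
proof (rule hausdorff1_delta_greatest)
  fix C :: "nat \<Rightarrow> 'a set"
  assume cov: "A \<union> B \<subseteq> (\<Union>i. C i)" and C: "\<And>i. bounded (C i)" "\<And>i. diameter (C i) \<le> \<delta>"
  define P where "P X i = (if C i \<inter> X = {} then {} else C i)" for X i
  have P: "hausdorff1_delta \<delta> X \<le> (\<Sum>i. ennreal (diameter (P X i)))" if X: "X \<subseteq> A \<union> B" for X
  proof (rule hausdorff1_delta_le, safe)
    fix x assume "x \<in> X"
    then obtain i where "x \<in> C i" using cov X by blast
    then have "x \<in> P X i" using \<open>x \<in> X\<close> by (auto simp: P_def)
    then show "x \<in> (\<Union>i. P X i)" by blast
  qed (use C \<delta> in \<open>auto simp: P_def\<close>)
  have le: "ennreal (diameter (P A i)) + ennreal (diameter (P B i)) \<le> ennreal (diameter (C i))" for i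
  proof -
    have "C i \<inter> A = {} \<or> C i \<inter> B = {}"
    proof (rule ccontr)
      assume "\<not> ?thesis"
      then obtain x y where "x \<in> C i" "x \<in> A" "y \<in> C i" "y \<in> B" by blast
      then have "r \<le> \<delta>"
        using sep diameter_bounded_bound[of "C i" x y] C[of i] by (meson order_trans)
      then show False using \<delta> by simp
    qed
    then show ?thesis by (auto simp: P_def)
  qed
  have "hausdorff1_delta \<delta> A + hausdorff1_delta \<delta> B \<le>
      (\<Sum>i. ennreal (diameter (P A i))) + (\<Sum>i. ennreal (diameter (P B i)))"
    by (intro add_mono P) auto
  also have "\<dots> = (\<Sum>i. ennreal (diameter (P A i)) + ennreal (diameter (P B i)))"
    by (intro suminf_add) auto
  also have "\<dots> \<le> (\<Sum>i. ennreal (diameter (C i)))" by (intro suminf_le le) auto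
  finally show "hausdorff1_delta \<delta> A + hausdorff1_delta \<delta> B \<le> (\<Sum>i. ennreal (diameter (C i)))" .
qed

lemma hausdorff1_outer_separated:
  fixes A B :: "'a::metric_space set"
  assumes r: "0 < r" and sep: "\<And>x y. x \<in> A \<Longrightarrow> y \<in> B \<Longrightarrow> r \<le> dist x y"
  shows "hausdorff1_outer A + hausdorff1_outer B \<le> hausdorff1_outer (A \<union> B)"
proof -
  have "hausdorff1_outer A + hausdorff1_outer B =
      (SUP \<delta>\<in>{0<..}. hausdorff1_delta \<delta> A + hausdorff1_delta \<delta> B)"
    unfolding hausdorff1_outer_def
  proof (rule SUP_add_directed_ennreal[symmetric])
    fix i j :: real assume "i \<in> {0<..}" "j \<in> {0<..}"
    then show "\<exists>k\<in>{0<..}. hausdorff1_delta i A + hausdorff1_delta j B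
        \<le> hausdorff1_delta k A + hausdorff1_delta k B"
      by (intro bexI[of _ "min i j"] add_mono hausdorff1_delta_antimono) auto
  qed
  also have "\<dots> \<le> hausdorff1_outer (A \<union> B)"
  proof (rule SUP_least)
    fix \<delta> :: real assume "\<delta> \<in> {0<..}"
    \<comment> \<open>The scale must be finer than the separation of the two sets.\<close>
    define \<eta> where "\<eta> = min \<delta> (r/2)"
    have \<eta>: "0 < \<eta>" "\<eta> < r" "\<eta> \<le> \<delta>" using r \<open>\<delta> \<in> _\<close> by (auto simp: \<eta>_def)
    have "hausdorff1_delta \<delta> A + hausdorff1_delta \<delta> B \<le> hausdorff1_delta \<eta> A + hausdorff1_delta \<eta> B"
      by (intro add_mono hausdorff1_delta_antimono \<eta>)
    also have "\<dots> \<le> hausdorff1_delta \<eta> (A \<union> B)"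
      by (rule hausdorff1_delta_separated[OF \<eta>(1,2) sep])
    also have "\<dots> \<le> hausdorff1_outer (A \<union> B)" by (rule hausdorff1_delta_le_outer[OF \<eta>(1)])
    finally show "hausdorff1_delta \<delta> A + hausdorff1_delta \<delta> B \<le> hausdorff1_outer (A \<union> B)" .
  qed
  finally show ?thesis .
qed

lemma
  fixes A :: "'a::metric_space set"
  shows space_hausdorff1 [simp]: "space (hausdorff1 :: 'a measure) = UNIV"
    and sets_hausdorff1: "sets (hausdorff1 :: 'a measure) = lambda_system UNIV UNIV hausdorff1_outer"
    and emeasure_hausdorff1: "A \<in> sets hausdorff1 \<Longrightarrow> emeasure hausdorff1 A = hausdorff1_outer A"
proof -
  interpret sigma_algebra UNIV "UNIV :: 'a set set" using sigma_algebra_Pow[of UNIV] by simp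
  have ms: "measure_space UNIV (lambda_system UNIV UNIV hausdorff1_outer) (hausdorff1_outer :: 'a set \<Rightarrow> _)"
    by (rule caratheodory_lemma[OF hausdorff1_outer_measure_space])
  then have sa: "sigma_algebra UNIV (lambda_system UNIV UNIV (hausdorff1_outer :: 'a set \<Rightarrow> _))"
    by (simp add: measure_space_def)
  show "space (hausdorff1 :: 'a measure) = UNIV" by (simp add: hausdorff1_def)
  show S: "sets (hausdorff1 :: 'a measure) = lambda_system UNIV UNIV hausdorff1_outer"
    using sigma_algebra.sets_measure_of_eq[OF sa] by (simp add: hausdorff1_def)
  show "emeasure hausdorff1 A = hausdorff1_outer A" if "A \<in> sets (hausdorff1 :: 'a measure)"
    using that ms unfolding S unfolding hausdorff1_def Pow_UNIV
    by (intro emeasure_measure_of_sigma) (auto simp: measure_space_def)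
qed

text \<open>
  This makes lower semicontinuous functions measurable, and it allows integrals against
  \<open>\<H>\<^sup>1\<close> to be compared with Borel measures.
\<close>

lemma sets_borel_subset_hausdorff1: "sets borel \<subseteq> sets (hausdorff1 :: 'a::metric_space measure)"
proof -
  have "closed F \<Longrightarrow> F \<in> sets hausdorff1" for F :: "'a set"
    unfolding sets_hausdorff1
    by (rule metric_outer_measure_closed[OF hausdorff1_outer_measure_space hausdorff1_outer_separated])
  then show ?thesis
    unfolding borel_eq_closed using sets.sigma_sets_subset[of "Collect closed" hausdorff1] by auto
qed

text \<open>
  Closing the covering sets changes neither their diameters nor the covering property, so a
  countable intersection of unions of closed almost optimal coverings is a hull.
\<close>

lemma hausdorff1_borel_hull:
  fixes A :: "'a::metric_space set"
  assumes fin: "hausdorff1_outer A < top"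
  obtains B where "B \<in> sets borel" "A \<subseteq> B" "hausdorff1_outer B = hausdorff1_outer A"
proof -
  \<comment> \<open>A null sequence of scales, used both as mesh size and as error of the coverings.\<close>
  define s where "s n = 1 / real (Suc n)" for n
  have s: "s n > 0" for n by (simp add: s_def)
  have "hausdorff1_delta (s n) A < top" for n
    using hausdorff1_delta_le_outer[OF s, of n A] fin by (rule order_le_less_trans)
  then have "\<exists>C. A \<subseteq> (\<Union>i::nat. C i) \<and> (\<forall>i. bounded (C i) \<and> diameter (C i) \<le> s n) \<and>
      (\<Sum>i. ennreal (diameter (C i))) \<le> hausdorff1_delta (s n) A + ennreal (s n)" for n
    using hausdorff1_delta_approx[of "s n" A "s n"] s by metis
  then obtain C where C: "\<And>n. A \<subseteq> (\<Union>i::nat. C n i)" "\<And>n i. bounded (C n i)"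
      "\<And>n i. diameter (C n i) \<le> s n"
      "\<And>n. (\<Sum>i. ennreal (diameter (C n i))) \<le> hausdorff1_delta (s n) A + ennreal (s n)"
    by metis
  define B where "B = (\<Inter>n. \<Union>i. closure (C n i))"
  have "A \<subseteq> (\<Union>i. closure (C n i))" for n
    by (rule order_trans[OF C(1)[of n]]) (intro UN_mono closure_subset order_refl)
  then have "A \<subseteq> B" unfolding B_def by (intro INT_greatest)
  have small: "hausdorff1_delta (s n) B \<le> hausdorff1_outer A + ennreal (s n)" for n
  proof -
    have "hausdorff1_delta (s n) B \<le> (\<Sum>i. ennreal (diameter (closure (C n i))))"
    proof (rule hausdorff1_delta_le)
      show "B \<subseteq> (\<Union>i. closure (C n i))" unfolding B_def by (rule INT_lower) simp
    qed (simp_all add: C(2,3) diameter_closure bounded_closure)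
    also have "\<dots> \<le> hausdorff1_delta (s n) A + ennreal (s n)"
      using C(4)[of n] by (simp add: diameter_closure C(2))
    also have "\<dots> \<le> hausdorff1_outer A + ennreal (s n)"
      by (intro add_right_mono hausdorff1_delta_le_outer s)
    finally show ?thesis .
  qed
  have "hausdorff1_outer B \<le> hausdorff1_outer A"
    unfolding hausdorff1_outer_def[of B]
  proof (rule SUP_least, rule ennreal_le_epsilon)
    fix \<delta> e :: real assume "\<delta> \<in> {0<..}" and e: "0 < e"
    then have "0 < min \<delta> e" by simp
    then obtain n where n: "s n < min \<delta> e"
      unfolding s_def by (rule nat_approx_posE)
    have "hausdorff1_delta \<delta> B \<le> hausdorff1_delta (s n) B"
      using n by (intro hausdorff1_delta_antimono) auto
    also note small[of n]
    also have "hausdorff1_outer A + ennreal (s n) \<le> hausdorff1_outer A + ennreal e"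
      using n by (intro add_left_mono ennreal_leI) auto
    finally show "hausdorff1_delta \<delta> B \<le> hausdorff1_outer A + ennreal e" .
  qed
  moreover have "hausdorff1_outer A \<le> hausdorff1_outer B"
    using hausdorff1_outer_measure_space \<open>A \<subseteq> B\<close>
    by (auto simp: outer_measure_space_def increasing_def)
  moreover have "B \<in> sets borel"
    unfolding B_def by (intro sets.countable_INT sets.countable_UN) auto
  ultimately show ?thesis using that[of B] \<open>A \<subseteq> B\<close> by simp
qed

text \<open>
  For a Borel hull \<open>B\<close> of \<open>A\<close>, the difference \<open>B - A\<close> is null because \<open>A\<close> is measurable of finite
  measure. Removing a Borel null set that contains this difference from \<open>B\<close> leaves the kernel.
\<close>

lemma hausdorff1_borel_kernel:
  fixes A :: "'a::metric_space set"
  assumes A: "A \<in> sets hausdorff1" and fin: "emeasure hausdorff1 A < top"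
  obtains F where "F \<in> sets borel" "F \<subseteq> A" "A - F \<in> null_sets hausdorff1"
proof -
  note bs = subsetD[OF sets_borel_subset_hausdorff1]
  have hull: "\<exists>B\<in>sets borel. X \<subseteq> B \<and> emeasure hausdorff1 B = emeasure hausdorff1 X"
    if "X \<in> sets hausdorff1" "emeasure hausdorff1 X < top" for X :: "'a set"
    using hausdorff1_borel_hull[of X] that by (metis emeasure_hausdorff1 bs)
  obtain B where B: "B \<in> sets borel" "A \<subseteq> B" "emeasure hausdorff1 B = emeasure hausdorff1 A"
    using hull A fin by blast
  have BA: "emeasure hausdorff1 (B - A) = 0"
    using emeasure_Diff[of hausdorff1 A B] A B bs fin by (auto simp: less_top)
  obtain N where N: "N \<in> sets borel" "B - A \<subseteq> N" "emeasure hausdorff1 N = 0"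
    using hull[of "B - A"] A B bs BA by auto
  show ?thesis
  proof
    show "B - N \<in> sets borel" using B N by auto
    show "B - N \<subseteq> A" using N by auto
    have "N \<in> null_sets hausdorff1" using N bs by auto
    moreover have "A - (B - N) \<in> sets hausdorff1"
      by (intro sets.Diff A bs[OF B(1)] bs[OF N(1)])
    moreover have "A - (B - N) \<subseteq> N" using B by auto
    ultimately show "A - (B - N) \<in> null_sets hausdorff1" by (rule null_sets_subset)
  qed
qed

section \<open>Outer regularity of weighted Hausdorff measure\<close>

text \<open>
  The finite measure with density \<open>w\<close> is outer regular on Borel sets because the space is
  Polish. The set \<open>E\<close> is only Caratheodory measurable, so it is first enlarged to a Borel set
  \<open>B\<close> without increasing its weighted measure. A Borel hull of \<open>E\<close> itself may be useless, since
  the Hausdorff measure of \<open>E\<close> may be infinite. Instead, what is removed from \<open>S\<close> to get \<open>B\<close> is a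
  Borel kernel of the part of the complement of \<open>E\<close> where \<open>w\<close> is positive. By Markov's
  inequality this part is a countable union of sets \<open>A k\<close> of finite measure.
\<close>

lemma weighted_hausdorff1_outer_regular:
  fixes S :: "'a::{second_countable_topology, complete_space} set" and w :: "'a \<Rightarrow> real"
  defines "M \<equiv> restrict_space hausdorff1 S"
  assumes S: "S \<in> sets borel"
    and w [measurable]: "w \<in> borel_measurable M"
    and w_nonneg: "\<And>x. 0 \<le> w x"
    and w_fin: "(\<integral>\<^sup>+x. ennreal (w x) \<partial>M) < top"
    and E: "E \<in> sets M" and e: "0 < (e::real)"
  obtains U where "open U" "E \<subseteq> U"
    "(\<integral>\<^sup>+x. ennreal (w x) * indicator (U \<inter> S - E) x \<partial>M) \<le> ennreal e"
proof -
  note borelH = subsetD[OF sets_borel_subset_hausdorff1]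
  have SH: "S \<inter> space hausdorff1 \<in> sets hausdorff1" using borelH[OF S] by simp
  have space_M [simp]: "space M = S" by (simp add: M_def space_restrict_space)
  have setsM: "A \<in> sets M \<longleftrightarrow> A \<subseteq> S \<and> A \<in> sets hausdorff1" for A
    unfolding M_def by (rule sets_restrict_space_iff[OF SH])
  have emM: "emeasure M A = emeasure hausdorff1 A" if "A \<subseteq> S" for A
    unfolding M_def by (rule emeasure_restrict_space[OF SH that])
  have borelM: "B \<inter> S \<in> sets M" if "B \<in> sets borel" for B
    using borelH[OF that] borelH[OF S] by (simp add: setsM sets.Int)
  define A where "A k = {x \<in> space M. 1 \<le> real (Suc k) * w x} - E" for k
  have level: "{x \<in> space M. 1 \<le> real (Suc k) * w x} \<in> sets M" for k by measurable
  have A: "A k \<in> sets M" for k unfolding A_def by (intro sets.Diff level E)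
  have A_fin: "emeasure hausdorff1 (A k) < top" for k
  proof -
    have "emeasure hausdorff1 (A k) = emeasure M (A k)" using A[of k] emM setsM by simp
    also have "\<dots> \<le> emeasure M {x \<in> space M. 1 \<le> real (Suc k) * w x}"
      by (rule emeasure_mono[OF _ level]) (auto simp: A_def)
    also have "\<dots> = emeasure M
        {x \<in> space M. 1 \<le> ennreal (real (Suc k)) * ennreal (w x)}"
      by (simp only: ennreal_mult''[OF w_nonneg, symmetric] ennreal_ge_1)
    also have "\<dots> \<le> ennreal (real (Suc k)) * (\<integral>\<^sup>+x. ennreal (w x) * indicator (space M) x \<partial>M)"
      by (rule nn_integral_Markov_inequality) 
        (intro borel_measurable_times_ennreal borel_measurable_indicator
          measurable_compose[OF w measurable_ennreal] sets.top)+
    also have "(\<integral>\<^sup>+x. ennreal (w x) * indicator (space M) x \<partial>M) = (\<integral>\<^sup>+x. ennreal (w x) \<partial>M)"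
      by (intro nn_integral_cong) auto
    also have "ennreal (real (Suc k)) * \<dots> < top" using w_fin by (simp add: ennreal_mult_less_top)
    finally show ?thesis .
  qed
  have "\<exists>F. F \<in> sets borel \<and> F \<subseteq> A k \<and> A k - F \<in> null_sets hausdorff1" for k
    using hausdorff1_borel_kernel[of "A k"] A[of k] A_fin[of k] setsM by metis
  then obtain F where F: "\<And>k. F k \<in> sets borel" "\<And>k. F k \<subseteq> A k"
      "\<And>k. A k - F k \<in> null_sets hausdorff1"
    by metis
  define B where "B = S - (\<Union>k. F k)"
  have B_borel: "B \<in> sets borel" unfolding B_def using S F(1) by auto
  have ES: "E \<subseteq> S" using E setsM by simp
  have EB: "E \<subseteq> B" using ES F(2) by (auto simp: B_def A_def)
  have B: "B \<in> sets M" using borelM[OF B_borel] by (simp add: B_def Int_absorb2)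
  have "A k - F k \<in> null_sets M" for k
  proof -
    have "A k - F k \<subseteq> S" using A[of k] setsM by auto
    then show ?thesis using F(3)[of k] emM[of "A k - F k"] by (auto simp: null_sets_def setsM)
  qed
  then have null: "(\<Union>k. A k - F k) \<in> null_sets M" by blast
  have zero: "(\<integral>\<^sup>+x. ennreal (w x) * indicator (B - E) x \<partial>M) = 0"
  proof -
    have "AE x in M. ennreal (w x) * indicator (B - E) x = 0"
    proof (rule AE_I'[OF null], rule subsetI)
      fix x assume "x \<in> {x \<in> space M. \<not> ennreal (w x) * indicator (B - E) x = 0}"
      then have x: "x \<in> S" "x \<in> B" "x \<notin> E" "0 < w x"
        by (auto simp: indicator_def ennreal_eq_0_iff split: if_splits)
      obtain k where "1 / real (Suc k) < w x" using nat_approx_posE[OF x(4)] .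
      then have "x \<in> A k" using x by (simp add: A_def field_simps)
      then show "x \<in> (\<Union>k. A k - F k)" using x(2) by (auto simp: B_def)
    qed
    then show ?thesis using B E by (subst nn_integral_0_iff_AE) auto
  qed
  define \<nu> where "\<nu> = distr (density M (\<lambda>x. ennreal (w x))) borel (\<lambda>x. x)"
  have id: "(\<lambda>x. x) \<in> measurable (density M (\<lambda>x. ennreal (w x))) borel"
    by (rule measurableI) (auto dest: borelM)
  have \<nu>: "emeasure \<nu> C = (\<integral>\<^sup>+x. ennreal (w x) * indicator (C \<inter> S) x \<partial>M)" if "C \<in> sets borel" for C
    unfolding \<nu>_def using borelM[OF that]
    by (subst emeasure_distr[OF id that]) (simp add: emeasure_density)
  have \<nu>_fin: "emeasure \<nu> C < top" if "C \<in> sets borel" for C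
    unfolding \<nu>[OF that]
    by (rule order_le_less_trans[OF _ w_fin], intro nn_integral_mono) (simp add: indicator_def)
  have "emeasure \<nu> (space \<nu>) \<noteq> \<infinity>" using \<nu>_fin[of UNIV] by (simp add: \<nu>_def)
  from outer_regular[OF _ this B_borel]
  have inf: "emeasure \<nu> B = (INF U\<in>{U. B \<subseteq> U \<and> open U}. emeasure \<nu> U)" by (simp add: \<nu>_def)
  have "emeasure \<nu> B \<noteq> \<infinity>" using \<nu>_fin[OF B_borel] by simp
  from INF_approx_ennreal[OF e inf this]
  obtain U where U: "B \<subseteq> U" "open U" "emeasure \<nu> U < emeasure \<nu> B + ennreal e" by auto
  have US: "U \<inter> S \<in> sets M" using borelM U(2) by simp
  have BS: "B \<inter> S = B" by (auto simp: B_def)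
  have le: "(\<integral>\<^sup>+x. ennreal (w x) * indicator (U \<inter> S - E) x \<partial>M) \<le> ennreal e"
  proof -
    have "(\<integral>\<^sup>+x. ennreal (w x) * indicator (U \<inter> S - E) x \<partial>M)
        = (\<integral>\<^sup>+x. ennreal (w x) * indicator (U \<inter> S - B) x + ennreal (w x) * indicator (B - E) x \<partial>M)"
      using U(1) EB BS by (intro nn_integral_cong) (auto simp: indicator_def)
    also have "\<dots> = (\<integral>\<^sup>+x. ennreal (w x) * indicator (U \<inter> S - B) x \<partial>M)"
      using US B E zero by (subst nn_integral_add) auto
    finally have eq: "(\<integral>\<^sup>+x. ennreal (w x) * indicator (U \<inter> S - E) x \<partial>M)
        = (\<integral>\<^sup>+x. ennreal (w x) * indicator (U \<inter> S - B) x \<partial>M)" .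
    have "emeasure \<nu> U = (\<integral>\<^sup>+x. ennreal (w x) * indicator B x
        + ennreal (w x) * indicator (U \<inter> S - B) x \<partial>M)"
      unfolding \<nu>[OF borel_open[OF U(2)]]
      using U(1) BS by (intro nn_integral_cong) (auto simp: indicator_def)
    also have "\<dots> = emeasure \<nu> B + (\<integral>\<^sup>+x. ennreal (w x) * indicator (U \<inter> S - B) x \<partial>M)"
      unfolding \<nu>[OF B_borel] BS using US B by (subst nn_integral_add) auto
    finally have "emeasure \<nu> B + (\<integral>\<^sup>+x. ennreal (w x) * indicator (U \<inter> S - B) x \<partial>M)
        \<le> emeasure \<nu> B + ennreal e"
      using less_imp_le[OF U(3)] by simp
    then show ?thesis unfolding eq using \<nu>_fin[OF B_borel] by (auto simp: ennreal_add_left_cancel_le)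
  qed
  show ?thesis by (rule that[OF U(2) _ le]) (use EB U(1) in blast)
qed

section \<open>Approximation by lower semicontinuous functions\<close>

lemma lower_semicontinuous_on_step:
  fixes U :: "nat \<Rightarrow> 'a::topological_space set"
  assumes U: "\<And>k. k < N \<Longrightarrow> open (U k)" and c: "0 \<le> c"
  shows "lower_semicontinuous_on S (\<lambda>x. \<Sum>k<N. c * indicator (U k) x)"
  unfolding lower_semicontinuous_on_def
proof (intro ballI allI impI)
  fix x y assume y: "y < (\<Sum>k<N. c * indicator (U k) x)"
  define V where "V = (\<Inter>k\<in>{k. k < N \<and> x \<in> U k}. U k)"
  have "open V" unfolding V_def using U by (intro open_INT) auto
  moreover have "x \<in> V" by (simp add: V_def)
  moreover have "y < (\<Sum>k<N. c * indicator (U k) z)" if "z \<in> V" for z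
    using y
  proof (rule order_less_le_trans, intro sum_mono)
    fix k assume "k \<in> {..<N}"
    then show "c * indicator (U k) x \<le> c * indicator (U k) z"
      using that c by (auto simp: V_def indicator_def)
  qed
  ultimately show "\<forall>\<^sub>F z in at x within S. y < (\<Sum>k<N. c * indicator (U k) z)"
    unfolding eventually_at_topological by blast
qed

lemma borel_measurable_lower_semicontinuous_on:
  assumes lsc: "lower_semicontinuous_on (space M) b"
    and op: "\<And>U. open U \<Longrightarrow> U \<inter> space M \<in> sets M"
  shows "b \<in> borel_measurable M"
proof (rule borel_measurableI_greater)
  fix y :: real
  define V where "V = \<Union>{W. open W \<and> (\<forall>z\<in>W \<inter> space M. y < b z)}"
  have "x \<in> V" if "x \<in> space M" "y < b x" for x
  proof -
    have "\<forall>\<^sub>F z in at x within space M. y < b z"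
      using lsc that by (simp add: lower_semicontinuous_on_def)
    then obtain W where "open W" "x \<in> W" "\<And>z. z \<in> W \<Longrightarrow> z \<noteq> x \<Longrightarrow> z \<in> space M \<Longrightarrow> y < b z"
      unfolding eventually_at_topological by blast
    then show ?thesis using that(2) by (auto simp: V_def intro!: exI[of _ W])
  qed
  then have "{x \<in> space M. y < b x} = V \<inter> space M" by (auto simp: V_def)
  moreover have "open V" unfolding V_def by (intro open_Union) simp
  ultimately show "{x \<in> space M. y < b x} \<in> sets M" using op by simp
qed

text \<open>
  The sum counts the grid points \<open>k * T / N\<close> below \<open>y\<close>: it is \<open>y\<close> rounded up to the grid. Summed
  over \<open>k\<close>, the indicators of the sets where \<open>g\<close> exceeds \<open>k * T / N\<close> therefore approximate a
  function \<open>g\<close> from above, by a sum in which each superlevel set can be enlarged separately.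
\<close>

lemma threshold_sum_approx:
  assumes y: "0 \<le> y" "y \<le> T" and N: "0 < (N::nat)"
  defines "q \<equiv> (\<Sum>k<N. T / N * indicator {k. k * T / N < y} k :: real)"
  shows "y \<le> q" "q \<le> y + T / N"
proof -
  define n where "n = nat \<lceil>y * N / T\<rceil>"
  have T: "0 \<le> T" using y by simp
  have "y \<le> q \<and> q \<le> y + T / N"
  proof (cases "T = 0")
    case True then show ?thesis using y by (simp add: q_def)
  next
    case False
    then have T: "T > 0" using T by simp
    have "y * N / T \<le> N" using y T N by (simp add: field_simps mult_right_mono)
    then have nN: "n \<le> N" by (simp add: n_def nat_le_iff ceiling_le_iff)
    have nn: "0 \<le> y * N / T" using y T by simp
    have iff: "real k * T / N < y \<longleftrightarrow> k < n" for k
    proof -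
      have "real k * T / N < y \<longleftrightarrow> real k < y * N / T" using T N by (simp add: field_simps)
      also have "\<dots> \<longleftrightarrow> k < n" unfolding n_def zless_nat_eq_int_zless less_ceiling_iff by simp
      finally show ?thesis .
    qed
    have "q = (\<Sum>k<N. if k \<in> {..<n} then T / N else 0)"
      unfolding q_def by (intro sum.cong) (auto simp: indicator_def iff)
    also have "\<dots> = (\<Sum>k\<in>{..<N} \<inter> {..<n}. T / N)" by (rule sum.inter_restrict[symmetric]) simp
    also have "{..<N} \<inter> {..<n} = {..<n}" using nN by auto
    finally have q: "q = n * T / N" by simp
    have "y * N / T \<le> n" using nn unfolding n_def by linarith
    moreover have "n \<le> y * N / T + 1" using nn unfolding n_def by linarith
    ultimately have "y * N \<le> n * T" "n * T \<le> y * N + T" using T by (simp_all add: field_simps)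
    then show ?thesis unfolding q using N by (simp add: field_simps)
  qed
  then show "y \<le> q" "q \<le> y + T / N" by auto
qed

text \<open>
  The Vitali-Caratheodory theorem for a function with values in \<open>[0,T]\<close>. Round \<open>g\<close> up to a sum of
  indicators of superlevel sets \<open>E k\<close> and replace each \<open>E k\<close> by a slightly larger open set
  \<open>U k\<close>. The sum becomes lower semicontinuous and can only increase, and with \<open>N\<close> summands of
  size \<open>T / N\<close> it never exceeds \<open>T\<close>. The rounding and the enlargement each cost at most \<open>e / 2\<close>.
\<close>

lemma vitali_caratheodory_above:
  fixes M :: "'a::topological_space measure" and w g :: "'a \<Rightarrow> real"
  assumes op: "\<And>U. open U \<Longrightarrow> U \<inter> space M \<in> sets M"
    and w [measurable]: "w \<in> borel_measurable M" and w_nonneg: "\<And>x. 0 \<le> w x"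
    and w_fin: "(\<integral>\<^sup>+x. ennreal (w x) \<partial>M) < top"
    and reg: "\<And>E e. E \<in> sets M \<Longrightarrow> 0 < (e::real) \<Longrightarrow> \<exists>U. open U \<and> E \<subseteq> U \<and>
      (\<integral>\<^sup>+x. ennreal (w x) * indicator (U \<inter> space M - E) x \<partial>M) \<le> ennreal e"
    and g [measurable]: "g \<in> borel_measurable M"
    and g_range: "\<And>x. 0 \<le> g x" "\<And>x. g x \<le> T"
    and e: "0 < (e::real)"
  obtains b where "lower_semicontinuous_on (space M) b"
    "\<And>x. x \<in> space M \<Longrightarrow> g x \<le> b x" "\<And>x. b x \<le> T"
    "(\<integral>\<^sup>+x. ennreal (b x * w x) \<partial>M) \<le> (\<integral>\<^sup>+x. ennreal (g x * w x) \<partial>M) + ennreal e"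
proof -
  have T: "0 \<le> T" using g_range order_trans by blast
  obtain W where W: "(\<integral>\<^sup>+x. ennreal (w x) \<partial>M) = ennreal W" "0 \<le> W"
    using w_fin by (cases "\<integral>\<^sup>+x. ennreal (w x) \<partial>M" rule: ennreal_cases) auto
  \<comment> \<open>The mesh \<open>T / N\<close> bounds the rounding error \<open>T / N * W\<close> by \<open>e / 2\<close>.\<close>
  obtain N :: nat where N: "2 * T * W / e < N" using reals_Archimedean2 by blast
  moreover have "0 \<le> 2 * T * W / e" using T W e by simp
  ultimately have N0: "0 < N" using of_nat_0_less_iff by (metis order_le_less_trans)
  have TW: "T / N * W \<le> e / 2" using N N0 e by (simp add: field_simps)
  \<comment> \<open>The enlargements cost at most \<open>N * (T / N) * \<delta>\<close> in total; the \<open>+ 1\<close> covers the case \<open>T = 0\<close>.\<close>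
  define \<delta> where "\<delta> = e / (2 * (T + 1))"
  have \<delta>: "0 < \<delta>" "T * \<delta> \<le> e / 2" using T e by (simp_all add: \<delta>_def field_simps)
  define E where "E k = {x \<in> space M. k * T / N < g x}" for k :: nat
  have E [measurable]: "E k \<in> sets M" for k unfolding E_def by measurable
  have "\<exists>U. open U \<and> E k \<subseteq> U \<and>
      (\<integral>\<^sup>+x. ennreal (w x) * indicator (U \<inter> space M - E k) x \<partial>M) \<le> ennreal \<delta>" for k
    by (rule reg[OF E \<delta>(1)])
  then obtain U where U: "\<And>k. open (U k)" "\<And>k. E k \<subseteq> U k"
      "\<And>k. (\<integral>\<^sup>+x. ennreal (w x) * indicator (U k \<inter> space M - E k) x \<partial>M) \<le> ennreal \<delta>"
    by metis
  define D where "D k = U k \<inter> space M - E k" for k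
  have D [measurable]: "D k \<in> sets M" for k unfolding D_def using op[OF U(1)] E by auto
  define c where "c = T / N"
  have c: "0 \<le> c" using T by (simp add: c_def)
  define b where "b x = (\<Sum>k<N. c * indicator (U k) x)" for x
  have q: "g x \<le> (\<Sum>k<N. c * indicator (E k) x)" "(\<Sum>k<N. c * indicator (E k) x) \<le> g x + c"
    if "x \<in> space M" for x
  proof -
    have "(\<Sum>k<N. c * indicator (E k) x) = (\<Sum>k<N. T / N * indicator {k. k * T / N < g x} k)"
      using that by (intro sum.cong) (auto simp: c_def E_def indicator_def)
    then show "g x \<le> (\<Sum>k<N. c * indicator (E k) x)" "(\<Sum>k<N. c * indicator (E k) x) \<le> g x + c"
      using threshold_sum_approx[OF g_range N0, of x] by (simp_all add: c_def)
  qed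
  show ?thesis
  proof (rule that[of b])
    show "lower_semicontinuous_on (space M) b"
      unfolding b_def by (rule lower_semicontinuous_on_step[OF U(1) c])
    show "g x \<le> b x" if "x \<in> space M" for x
      unfolding b_def using U(2) c
      by (intro order_trans[OF q(1)[OF that]] sum_mono) (auto simp: indicator_def)
    show "b x \<le> T" for x
    proof -
      have "b x \<le> (\<Sum>k<N. c)" unfolding b_def using c by (intro sum_mono) (auto simp: indicator_def)
      then show ?thesis using N0 by (simp add: c_def)
    qed
    have bound: "ennreal (b x * w x) \<le> ennreal (g x * w x) + ennreal c * ennreal (w x)
        + (\<Sum>k<N. ennreal c * (ennreal (w x) * indicator (D k) x))" if x: "x \<in> space M" for x
    proof -
      have "b x = (\<Sum>k<N. c * indicator (E k) x) + (\<Sum>k<N. c * indicator (D k) x)"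
        unfolding b_def sum.distrib[symmetric] using U(2) x
        by (intro sum.cong) (auto simp: D_def indicator_def)
      then have "b x \<le> g x + c + (\<Sum>k<N. c * indicator (D k) x)" using q(2)[OF x] by simp
      then have "b x * w x \<le> (g x + c + (\<Sum>k<N. c * indicator (D k) x)) * w x"
        using w_nonneg by (intro mult_right_mono)
      also have "\<dots> = g x * w x + c * w x + (\<Sum>k<N. c * (w x * indicator (D k) x))"
        by (simp only: distrib_right sum_distrib_right mult.assoc
            mult.commute[of "indicator A x" "w x" for A])
      finally have "ennreal (b x * w x) \<le> ennreal \<dots>" by (rule ennreal_leI)
      also have "\<dots> = ennreal (g x * w x) + ennreal (c * w x)
          + (\<Sum>k<N. ennreal (c * (w x * indicator (D k) x)))"
        using c w_nonneg g_range by (simp add: sum_nonneg flip: sum_ennreal)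
      also have "\<dots> = ennreal (g x * w x) + ennreal c * ennreal (w x)
          + (\<Sum>k<N. ennreal c * (ennreal (w x) * indicator (D k) x))"
        using c w_nonneg by (simp add: ennreal_mult ennreal_indicator)
      finally show ?thesis .
    qed
    have "(\<integral>\<^sup>+x. ennreal (b x * w x) \<partial>M) \<le> (\<integral>\<^sup>+x. ennreal (g x * w x) + ennreal c * ennreal (w x)
        + (\<Sum>k<N. ennreal c * (ennreal (w x) * indicator (D k) x)) \<partial>M)"
      by (rule nn_integral_mono[OF bound])
    also have "\<dots> = (\<integral>\<^sup>+x. ennreal (g x * w x) \<partial>M) + ennreal c * ennreal W
        + (\<Sum>k<N. ennreal c * (\<integral>\<^sup>+x. ennreal (w x) * indicator (D k) x \<partial>M))"
      by (simp add: nn_integral_add nn_integral_sum nn_integral_cmult W(1))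
    also have "\<dots> \<le> (\<integral>\<^sup>+x. ennreal (g x * w x) \<partial>M) + ennreal c * ennreal W
        + (\<Sum>k<N. ennreal c * ennreal \<delta>)"
      unfolding D_def by (intro add_left_mono sum_mono mult_left_mono U(3)) auto
    also have "\<dots> = (\<integral>\<^sup>+x. ennreal (g x * w x) \<partial>M) + ennreal (c * W + N * (c * \<delta>))"
      using c W(2) \<delta>(1) by (simp add: add.assoc ennreal_mult ennreal_of_nat_eq_real_of_nat)
    also have "\<dots> \<le> (\<integral>\<^sup>+x. ennreal (g x * w x) \<partial>M) + ennreal e"
    proof (intro add_left_mono ennreal_leI)
      have "N * (c * \<delta>) = T * \<delta>" using N0 by (simp add: c_def)
      then show "c * W + N * (c * \<delta>) \<le> e" using TW \<delta>(2) unfolding c_def by linarith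
    qed
    finally show "(\<integral>\<^sup>+x. ennreal (b x * w x) \<partial>M) \<le> (\<integral>\<^sup>+x. ennreal (g x * w x) \<partial>M) + ennreal e" .
  qed
qed

section \<open>Duality between transportation and maintenance cost\<close>

text \<open>
  At \<open>m > 0\<close> the right derivative of the concave function \<open>\<tau>\<close> is a supergradient. It is
  nonnegative because \<open>\<tau>\<close> is nondecreasing, and at most \<open>T\<close> because \<open>\<tau> y \<le> T * y\<close>, which in turn
  follows since \<open>\<tau> y / y\<close> decreases in \<open>y\<close> and tends to \<open>T\<close> at \<open>0\<close>. At \<open>m = 0\<close> the slope \<open>T\<close> itself
  is a supergradient. Supergradients at distinct points are always ordered, so any selection
  is antitone and hence measurable.
\<close>

lemma transportation_cost_supergradient:
  assumes \<tau>: "transportation_cost \<tau>"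
    and lim: "((\<lambda>m. \<tau> m / m) \<longlongrightarrow> T) (at_right 0)"
  obtains \<beta> :: "real \<Rightarrow> real" where "antimono \<beta>" "\<And>m. 0 \<le> \<beta> m" "\<And>m. \<beta> m \<le> T"
    "\<And>m y. 0 \<le> m \<Longrightarrow> 0 \<le> y \<Longrightarrow> \<tau> y \<le> \<tau> m + \<beta> m * (y - m)"
proof -
  have nonneg: "\<And>m. 0 \<le> m \<Longrightarrow> 0 \<le> \<tau> m" and mono: "mono_on {0..} \<tau>"
    and conc: "concave_on {0..} \<tau>" and zero: "\<tau> 0 = 0"
    using \<tau> by (auto simp: transportation_cost_def)
  have T: "0 \<le> T"
  proof (rule tendsto_lowerbound[OF lim])
    show "\<forall>\<^sub>F s in at_right 0. 0 \<le> \<tau> s / s"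
      using eventually_at_right_less[of 0] by eventually_elim (intro divide_nonneg_nonneg nonneg, simp_all)
  qed simp
  have line: "\<tau> m \<le> T * m" if m: "0 \<le> m" for m
  proof (cases "m = 0")
    case False
    then have m: "0 < m" using m by simp
    \<comment> \<open>By concavity the quotient at \<open>m\<close> is at most the quotient at every smaller \<open>s\<close>.\<close>
    have "\<tau> m / m \<le> T"
    proof (rule tendsto_lowerbound[OF lim])
      show "\<forall>\<^sub>F s in at_right 0. \<tau> m / m \<le> \<tau> s / s"
        using eventually_at_right_real[OF m]
      proof eventually_elim
        fix s assume s: "s \<in> {0<..<m}"
        have "(1 - s / m) * \<tau> 0 + s / m * \<tau> m \<le> \<tau> ((1 - s / m) *\<^sub>R 0 + (s / m) *\<^sub>R m)"
          using s m by (intro concave_onD[OF conc]) auto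
        then have "s / m * \<tau> m \<le> \<tau> s" using m by (simp add: zero)
        then show "\<tau> m / m \<le> \<tau> s / s" using s m by (simp add: field_simps)
      qed
    qed simp
    then show ?thesis using m by (simp add: field_simps)
  qed (simp add: zero)
  have "\<exists>s. 0 \<le> s \<and> s \<le> T \<and> (\<forall>y\<ge>0. \<tau> y \<le> \<tau> m + s * (y - m)) \<and> (m = 0 \<longrightarrow> s = T)"
    if m: "0 \<le> m" for m
  proof (cases "m = 0")
    case True
    then show ?thesis using T line by (auto simp: zero)
  next
    case False
    then have m: "0 < m" using m by simp
    define s where "s = - Inf ((\<lambda>t. (- \<tau> m - - \<tau> t) / (m - t)) ` ({m<..} \<inter> {0..}))"
    have conv: "convex_on {0..} (\<lambda>x. - \<tau> x)" using conc by (simp add: concave_on_def)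
    have sg: "\<tau> y \<le> \<tau> m + s * (y - m)" if "0 \<le> y" for y
      using convex_le_Inf_differential[OF conv, of m y] m that by (simp add: s_def)
    have "\<tau> m \<le> \<tau> (m + 1)" using m by (intro mono_onD[OF mono]) auto
    then have "0 \<le> s" using sg[of "m + 1"] m by simp
    moreover have "s \<le> T"
    proof -
      have "s * m \<le> \<tau> m" using sg[of 0] by (simp add: zero)
      also have "\<dots> \<le> T * m" using line m by simp
      finally show ?thesis using m by simp
    qed
    ultimately show ?thesis using sg m by auto
  qed
  then obtain \<beta> where \<beta>: "\<And>m. 0 \<le> m \<Longrightarrow> 0 \<le> \<beta> m" "\<And>m. 0 \<le> m \<Longrightarrow> \<beta> m \<le> T"
      "\<And>m y. 0 \<le> m \<Longrightarrow> 0 \<le> y \<Longrightarrow> \<tau> y \<le> \<tau> m + \<beta> m * (y - m)"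
    by metis
  have anti: "\<beta> m' \<le> \<beta> m" if "0 \<le> m" "m \<le> m'" for m m'
  proof (cases "m = m'")
    case False
    have "\<tau> m' \<le> \<tau> m + \<beta> m * (m' - m)" "\<tau> m \<le> \<tau> m' + \<beta> m' * (m - m')"
      using that \<beta>(3) by auto
    then have "\<beta> m' * (m' - m) \<le> \<beta> m * (m' - m)" by (simp add: algebra_simps)
    then show ?thesis using False that by simp
  qed simp
  show ?thesis
  proof (rule that[of "\<lambda>m. \<beta> (max 0 m)"])
    show "antimono (\<lambda>m. \<beta> (max 0 m))" by (intro antimonoI anti) auto
  qed (use \<beta> in \<open>auto simp: max_def\<close>)
qed

text \<open>
  The maintenance cost is the Fenchel conjugate of \<open>-\<tau>\<close>, up to a reflection of the slope. This is
  the Fenchel-Young inequality; supergradients turn it into an equality.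
\<close>

lemma fenchel_young_maintenance_cost:
  assumes "0 \<le> m" "0 \<le> s"
  shows "ennreal (\<tau> m) \<le> ennreal (s * m) + maintenance_cost \<tau> s"
proof -
  have "ennreal (\<tau> m) \<le> ennreal (s * m) + ennreal (\<tau> m - s * m)"
  proof (cases "\<tau> m \<le> s * m")
    case True
    then show ?thesis by (simp add: ennreal_neg ennreal_leI)
  next
    case False
    then show ?thesis using assms by (subst ennreal_plus[symmetric]) auto
  qed
  also have "\<dots> \<le> ennreal (s * m) + maintenance_cost \<tau> s"
    unfolding maintenance_cost_def using assms by (intro add_left_mono SUP_upper) auto
  finally show ?thesis .
qed

lemma fenchel_young_maintenance_cost_eq:
  assumes "0 \<le> m" "0 \<le> s" "\<tau> 0 = 0" and sg: "\<And>y. 0 \<le> y \<Longrightarrow> \<tau> y \<le> \<tau> m + s * (y - m)"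
  shows "ennreal (s * m) + maintenance_cost \<tau> s = ennreal (\<tau> m)"
proof (rule antisym)
  have "maintenance_cost \<tau> s \<le> ennreal (\<tau> m - s * m)"
    unfolding maintenance_cost_def
  proof (rule SUP_least, rule ennreal_leI)
    fix y :: real assume "y \<in> {0..}"
    then show "\<tau> y - s * y \<le> \<tau> m - s * m" using sg[of y] by (simp add: algebra_simps)
  qed
  then have "ennreal (s * m) + maintenance_cost \<tau> s \<le> ennreal (s * m) + ennreal (\<tau> m - s * m)"
    by (rule add_left_mono)
  also have "\<dots> = ennreal (\<tau> m)"
    using assms sg[of 0] by (subst ennreal_plus[symmetric]) auto
  finally show "ennreal (s * m) + maintenance_cost \<tau> s \<le> ennreal (\<tau> m)" .
qed (rule fenchel_young_maintenance_cost[OF assms(1,2)])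

lemma maintenance_cost_antimono:
  assumes "s \<le> t" shows "maintenance_cost \<tau> t \<le> maintenance_cost \<tau> s"
  unfolding maintenance_cost_def
proof (rule SUP_mono)
  fix m :: real assume m: "m \<in> {0..}"
  then have "\<tau> m - t * m \<le> \<tau> m - s * m" using assms by (simp add: mult_right_mono)
  then show "\<exists>k\<in>{0..}. ennreal (\<tau> m - t * m) \<le> ennreal (\<tau> k - s * k)"
    using m by (blast intro: ennreal_leI)
qed

text \<open>
  As a supremum of continuous functions, the maintenance cost has open superlevel sets.
\<close>

lemma borel_measurable_maintenance_cost [measurable]: "maintenance_cost \<tau> \<in> borel_measurable borel"
proof (rule borel_measurableI_greater)
  fix a :: ennreal
  have "{s \<in> space borel. a < maintenance_cost \<tau> s} = (\<Union>m\<in>{0..}. {s. a < ennreal (\<tau> m - s * m)})"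
    by (auto simp: maintenance_cost_def less_SUP_iff)
  also have "open \<dots>"
    by (intro open_UN ballI open_Collect_less continuous_intros continuous_on_ennreal)
  finally show "{s \<in> space borel. a < maintenance_cost \<tau> s} \<in> sets borel" by simp
qed

section \<open>The minimization formula\<close>

theorem theorem1p3p7:
  fixes S :: "(real ^ 'n) set"
    and \<xi> :: "real ^ 'n \<Rightarrow> real ^ 'n"
    and \<tau> :: "real \<Rightarrow> real"
    and \<tau>'0 :: real
  assumes "S \<subseteq> {x. \<forall>i. x $ i \<in> {-1..1}}"
    and "countably_1_rectifiable S"
    and "S \<in> sets borel"
    and "integrable (restrict_space hausdorff1 S) \<xi>"
    and "transportation_cost \<tau>"
    and "((\<lambda>m. \<tau> m / m) \<longlongrightarrow> \<tau>'0) (at_right 0)"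
  shows "(\<integral>\<^sup>+x. ennreal (\<tau> (norm (\<xi> x))) \<partial>restrict_space hausdorff1 S) =
    (INF b\<in>{b. lower_semicontinuous_on S b \<and> b ` S \<subseteq> {0..\<tau>'0}}.
       (\<integral>\<^sup>+x. ennreal (b x * norm (\<xi> x)) \<partial>restrict_space hausdorff1 S) +
       (\<integral>\<^sup>+x. maintenance_cost \<tau> (b x) \<partial>restrict_space hausdorff1 S))"
proof -
  define M where "M = restrict_space hausdorff1 S"
  define w where "w x = norm (\<xi> x)" for x
  have space_M: "space M = S" by (simp add: M_def space_restrict_space)
  have \<xi>: "integrable M \<xi>" using assms(4) by (simp add: M_def)
  then have [measurable]: "\<xi> \<in> borel_measurable M" by (rule borel_measurable_integrable)
  have w [measurable]: "w \<in> borel_measurable M" unfolding w_def by measurable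
  have w_nonneg: "0 \<le> w x" for x by (simp add: w_def)
  have w_fin: "(\<integral>\<^sup>+x. ennreal (w x) \<partial>M) < top"
    using \<xi> by (simp add: integrable_iff_bounded w_def)
  have op: "U \<inter> space M \<in> sets M" if "open U" for U
  proof -
    have "U \<in> sets hausdorff1"
      by (rule subsetD[OF sets_borel_subset_hausdorff1 borel_open[OF that]])
    then show ?thesis
      unfolding space_M unfolding M_def sets_restrict_space by (intro image_eqI[of _ _ U]) auto
  qed
  obtain \<beta> where \<beta>: "antimono \<beta>" "\<And>m. 0 \<le> \<beta> m" "\<And>m. \<beta> m \<le> \<tau>'0"
    "\<And>m y. 0 \<le> m \<Longrightarrow> 0 \<le> y \<Longrightarrow> \<tau> y \<le> \<tau> m + \<beta> m * (y - m)"
    by (rule transportation_cost_supergradient[OF assms(5,6)], rule that) assumption+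
  have "(\<lambda>m. - \<beta> m) \<in> borel_measurable borel"
    using \<beta>(1) by (intro borel_measurable_mono) (simp add: monotone_def)
  then have [measurable]: "\<beta> \<in> borel_measurable borel" by simp
  \<comment> \<open>The pointwise optimal slope, which is in general not lower semicontinuous.\<close>
  define g where "g x = \<beta> (w x)" for x
  have g [measurable]: "g \<in> borel_measurable M" unfolding g_def by measurable
  define cost where
    "cost b = (\<integral>\<^sup>+x. ennreal (b x * w x) \<partial>M) + (\<integral>\<^sup>+x. maintenance_cost \<tau> (b x) \<partial>M)" for b
  have \<tau>0: "\<tau> 0 = 0" using assms(5) by (simp add: transportation_cost_def)
  have cost_g: "cost g = (\<integral>\<^sup>+x. ennreal (\<tau> (w x)) \<partial>M)"
  proof -
    have "cost g = (\<integral>\<^sup>+x. ennreal (g x * w x) + maintenance_cost \<tau> (g x) \<partial>M)"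
      unfolding cost_def by (rule nn_integral_add[symmetric]) measurable
    also have "\<dots> = (\<integral>\<^sup>+x. ennreal (\<tau> (w x)) \<partial>M)"
      unfolding g_def
      by (intro nn_integral_cong fenchel_young_maintenance_cost_eq w_nonneg \<tau>0 \<beta>(2) \<beta>(4))
    finally show ?thesis .
  qed
  have "(\<integral>\<^sup>+x. ennreal (\<tau> (w x)) \<partial>M) =
      (INF b\<in>{b. lower_semicontinuous_on S b \<and> b ` S \<subseteq> {0..\<tau>'0}}. cost b)"
  proof (rule antisym)
    show "(\<integral>\<^sup>+x. ennreal (\<tau> (w x)) \<partial>M) \<le>
        (INF b\<in>{b. lower_semicontinuous_on S b \<and> b ` S \<subseteq> {0..\<tau>'0}}. cost b)"
    proof (rule INF_greatest, clarify)
      fix b assume lsc: "lower_semicontinuous_on S b" and range: "b ` S \<subseteq> {0..\<tau>'0}"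
      have [measurable]: "b \<in> borel_measurable M"
        by (rule borel_measurable_lower_semicontinuous_on[OF _ op]) (simp_all add: space_M lsc)
      have "(\<integral>\<^sup>+x. ennreal (\<tau> (w x)) \<partial>M) \<le>
          (\<integral>\<^sup>+x. ennreal (b x * w x) + maintenance_cost \<tau> (b x) \<partial>M)"
        using range
        by (intro nn_integral_mono fenchel_young_maintenance_cost w_nonneg) (auto simp: space_M)
      also have "\<dots> = cost b" unfolding cost_def by (rule nn_integral_add) measurable
      finally show "(\<integral>\<^sup>+x. ennreal (\<tau> (w x)) \<partial>M) \<le> cost b" .
    qed
    show "(INF b\<in>{b. lower_semicontinuous_on S b \<and> b ` S \<subseteq> {0..\<tau>'0}}. cost b) \<le>
        (\<integral>\<^sup>+x. ennreal (\<tau> (w x)) \<partial>M)"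
    proof (rule ennreal_le_epsilon)
      fix e :: real assume e: "0 < e"
      have reg: "\<exists>U. open U \<and> E \<subseteq> U \<and>
          (\<integral>\<^sup>+x. ennreal (w x) * indicator (U \<inter> space M - E) x \<partial>M) \<le> ennreal d"
        if "E \<in> sets M" "0 < d" for E and d :: real
        using weighted_hausdorff1_outer_regular[OF assms(3), folded M_def, OF w w_nonneg w_fin that]
        unfolding space_M by metis
      obtain b where b: "lower_semicontinuous_on (space M) b"
        "\<And>x. x \<in> space M \<Longrightarrow> g x \<le> b x" "\<And>x. b x \<le> \<tau>'0"
        "(\<integral>\<^sup>+x. ennreal (b x * w x) \<partial>M) \<le> (\<integral>\<^sup>+x. ennreal (g x * w x) \<partial>M) + ennreal e"
        by (rule vitali_caratheodory_above[OF op w w_nonneg w_fin reg g _ _ e, of \<tau>'0])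
          (auto simp: g_def \<beta>)
      have "0 \<le> b x" if "x \<in> S" for x
        using b(2)[of x] \<beta>(2)[of "w x"] that by (simp add: g_def space_M)
      then have "(INF b\<in>{b. lower_semicontinuous_on S b \<and> b ` S \<subseteq> {0..\<tau>'0}}. cost b) \<le> cost b"
        using b(1,3) by (intro INF_lower) (auto simp: space_M)
      \<comment> \<open>Passing from \<open>g\<close> to the larger \<open>b\<close> does not raise the maintenance cost.\<close>
      also have "\<dots> \<le> ((\<integral>\<^sup>+x. ennreal (g x * w x) \<partial>M) + ennreal e)
          + (\<integral>\<^sup>+x. maintenance_cost \<tau> (g x) \<partial>M)"
        unfolding cost_def using b(2)
        by (intro add_mono b(4) nn_integral_mono maintenance_cost_antimono)
      also have "\<dots> = cost g + ennreal e" by (simp add: cost_def ac_simps)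
      also note cost_g
      finally show "(INF b\<in>{b. lower_semicontinuous_on S b \<and> b ` S \<subseteq> {0..\<tau>'0}}. cost b) \<le>
          (\<integral>\<^sup>+x. ennreal (\<tau> (w x)) \<partial>M) + ennreal e" .
    qed
  qed
  then show ?thesis unfolding cost_def w_def M_def .
qed

end
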